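(* There exists an atomic Puiseux monoid $M$ such that $\{2\} \notin \mathcal{L}(M)$.
   Context: A Puiseux monoid is an additive submonoid of $\mathbb{Q}_{\ge 0}$ (containing $0$). An atom of a Puiseux monoid $M$ is a nonzero element $a \in M$ such that $a = u+v$ with $u,v \in M$ implies $u = 0$ or $v = 0$; $\mathcal{A}(M)$ is the set of atoms, and $M$ is atomic if $\mathcal{A}(M)$ generates $M$. A factorization of $x \in M$ is a formal (unordered) sum $a_1 + \dots + a_n$ of atoms, i.e. an element of the free commutative monoid on $\mathcal{A}(M)$, whose value in $M$ is $x$; its length is $n$ (the empty sum, of length $0$, is the only factorization of $0$). The set of lengths $\mathsf{L}(x)$ is the set of all lengths of factorizations of $x$, and $\mathcal{L}(M) = \{\mathsf{L}(x) \mid x \in M\}$ is the system of sets of lengths of $M$. *)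

theory Defs
  imports Complex_Main "HOL-Library.Multiset"
begin

definition puiseux_monoid :: "rat set \<Rightarrow> bool" where
  "puiseux_monoid M \<longleftrightarrow>
     (\<forall>x\<in>M. 0 \<le> x) \<and> 0 \<in> M \<and> (\<forall>x\<in>M. \<forall>y\<in>M. x + y \<in> M)"

definition atoms :: "rat set \<Rightarrow> rat set" where
  "atoms M = {a \<in> M. a \<noteq> 0 \<and> (\<forall>u\<in>M. \<forall>v\<in>M. a = u + v \<longrightarrow> u = 0 \<or> v = 0)}"

(* The submonoids of the nonnegative rationals are exactly the Puiseux monoids, so
   the hull is the submonoid generated by the atoms. *)
definition atomic :: "rat set \<Rightarrow> bool" where
  "atomic M \<longleftrightarrow> puiseux_monoid hull (atoms M) = M"

(* Finite multisets of atoms model the free commutative monoid on the set of atoms. *)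
definition factorizations :: "rat set \<Rightarrow> rat \<Rightarrow> rat multiset set" where
  "factorizations M x = {F. set_mset F \<subseteq> atoms M \<and> sum_mset F = x}"

definition set_of_lengths :: "rat set \<Rightarrow> rat \<Rightarrow> nat set" where
  "set_of_lengths M x = size ` factorizations M x"

definition system_of_sets_of_lengths :: "rat set \<Rightarrow> nat set set" where
  "system_of_sets_of_lengths M = set_of_lengths M ` M"

end

(* Given finitely many atoms with common denominator d and two of them, a and b, put
   n = d (a + b) and p = 2 n + 1, and adjoin c = (a + b) / p. As p is coprime to n, the
   multiplicity of c in any sum lying in (1/d) Z is a multiple of p, and p copies of c
   may be replaced by a + b. So old atoms stay atoms, c is a new atom, and a + b acquires
   a factorization of length p >= 3. Treat all pairs of atoms and iterate. *)
theory Submission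
  imports Defs
begin

section \<open>Generated sums and sets of prospective atoms\<close>

definition msums :: "rat set \<Rightarrow> rat set" where
  "msums A = {sum_mset F | F. set_mset F \<subseteq> A}"

text \<open>Intrinsic form of "\<open>A\<close> is the set of atoms of the monoid it generates" (see
  \<open>atoms_msums\<close>). Each instance involves only finitely many elements of
  \<open>A\<close>, so the property survives increasing unions.\<close>

definition atomlike :: "rat set \<Rightarrow> bool" where
  "atomlike A \<longleftrightarrow> (\<forall>x\<in>A. 0 < x) \<and>
     (\<forall>F. set_mset F \<subseteq> A \<longrightarrow> sum_mset F \<in> A \<longrightarrow> F = {#sum_mset F#})"

lemma atomlike_pos: "atomlike A \<Longrightarrow> x \<in> A \<Longrightarrow> 0 < x"
  by (simp add: atomlike_def)

lemma atomlikeD: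
  "atomlike A \<Longrightarrow> set_mset F \<subseteq> A \<Longrightarrow> sum_mset F \<in> A \<Longrightarrow> F = {#sum_mset F#}"
  unfolding atomlike_def by blast

lemma sum_mset_nonneg_rat:
  fixes F :: "rat multiset"
  shows "\<forall>x\<in>#F. 0 < x \<Longrightarrow> 0 \<le> sum_mset F"
  by (induction F) auto

lemma sum_mset_eq_0_rat_iff:
  fixes F :: "rat multiset"
  assumes "\<forall>x\<in>#F. 0 < x"
  shows "sum_mset F = 0 \<longleftrightarrow> F = {#}"
proof (cases F)
  case (add x G)
  then have "0 < x" "0 \<le> sum_mset G"
    using assms sum_mset_nonneg_rat[of G] by auto
  then show ?thesis using add by simp
qed simp

lemma common_denominator:
  assumes "finite A"
  shows "\<exists>d::nat. 0 < d \<and> (\<forall>x\<in>A. of_nat d * x \<in> (\<int> :: rat set))"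
  using assms
proof induction
  case empty
  show ?case by (intro exI[of _ 1]) auto
next
  case (insert y A)
  then obtain d :: nat where d: "0 < d" "\<forall>x\<in>A. of_nat d * x \<in> \<int>" by blast
  obtain u v :: int where uv: "y = of_int u / of_int v" "0 < v"
    using quotient_of_div quotient_of_denom_pos by (metis surj_pair)
  have "of_nat (d * nat v) * y = of_int (int d * u)"
    using uv by simp
  then have "of_nat (d * nat v) * y \<in> \<int>" by (metis Ints_of_int)
  moreover have "of_nat (d * nat v) * x \<in> \<int>" if "x \<in> A" for x
  proof -
    have "of_nat (d * nat v) * x = of_int v * (of_nat d * x)"
      using uv by simp
    then show ?thesis using d(2) that by (metis Ints_mult Ints_of_int)
  qed
  moreover have "0 < d * nat v" using d(1) uv(2) by simp
  ultimately show ?case by blast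
qed

lemma sum_mset_denominator:
  fixes d :: rat
  shows "\<forall>x\<in>#F. d * x \<in> \<int> \<Longrightarrow> d * sum_mset F \<in> \<int>"
  by (induction F) (auto simp: distrib_left)

lemma atomlike_one: "atomlike {1}"
proof -
  have "F = {#sum_mset F#}" if "set_mset F \<subseteq> {1}" "sum_mset F \<in> {1}" for F :: "rat multiset"
  proof -
    have "F = replicate_mset (size F) 1"
      using that(1) by (auto intro: set_mset_subset_singletonD)
    then obtain k where k: "F = replicate_mset k 1" by blast
    then show ?thesis using that(2) by simp
  qed
  then show ?thesis unfolding atomlike_def by simp
qed

section \<open>Adjoining one new atom\<close>

lemma atomlike_extend:
  assumes "finite A" "atomlike A" "a \<in> A" "b \<in> A"
  shows "\<exists>c p. atomlike (insert c A) \<and> 3 \<le> p \<and> of_nat p * c = a + b"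
proof -
  obtain d :: nat where d: "0 < d" "\<forall>x\<in>A. of_nat d * x \<in> \<int>"
    using common_denominator[OF assms(1)] by blast
  have pos: "0 < a" "0 < b" using assms atomlike_pos by auto
  have "of_nat d * (a + b) \<in> \<int>" using d assms by (simp add: distrib_left)
  then obtain n where n: "of_nat d * (a + b) = of_int n" by (elim Ints_cases)
  have "of_int n > (0::rat)" using pos d(1) unfolding n[symmetric] by simp
  \<comment> \<open>Positivity of \<open>n\<close> gives \<open>p\<close> \<ge> 3, so the new
    factorization of \<open>a + b\<close> is longer than 2.\<close>
  then have n0: "0 < n" by simp
  define p where "p = 2 * n + 1"
  define c where "c = (a + b) / of_int p"
  have p: "3 \<le> p" using n0 by (simp add: p_def)
  have c0: "0 < c" using pos p by (simp add: c_def)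
  have pc: "of_int p * c = a + b" using p by (simp add: c_def)
  have cop: "coprime p n"
  proof (rule coprimeI)
    fix l assume "l dvd p" "l dvd n"
    then have "l dvd p - 2 * n" by (intro dvd_diff dvd_mult)
    then show "is_unit l" by (simp add: p_def)
  qed
  \<comment> \<open>Since \<open>d * p * c = n\<close>, integrality of \<open>d * k * c\<close>
    means that \<open>p\<close> divides \<open>k * n\<close>, and \<open>p\<close> is coprime to
    \<open>n\<close>.\<close>
  have key: "p dvd k" if k: "of_nat d * (of_int k * c) \<in> \<int>" for k :: int
  proof -
    obtain m where m: "of_nat d * (of_int k * c) = of_int m" using k by (elim Ints_cases)
    have "(of_int (p * m) :: rat) = of_int k * (of_nat d * (of_int p * c))"
      by (simp add: m[symmetric])
    also have "\<dots> = of_int (k * n)" by (simp add: pc n)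
    finally have "p * m = k * n" by linarith
    then have "p dvd k * n" by (metis dvd_triv_left)
    then show ?thesis using cop by (simp add: coprime_dvd_mult_left_iff)
  qed
  have cA: "c \<notin> A"
  proof
    assume "c \<in> A"
    then have "p dvd 1" using key[of 1] d by simp
    then show False using p by simp
  qed
  have "F = {#sum_mset F#}" if F: "set_mset F \<subseteq> insert c A" "sum_mset F \<in> insert c A" for F
  proof -
    \<comment> \<open>Split \<open>F\<close> into its \<open>k\<close> copies of \<open>c\<close>
      and a rest \<open>G\<close> over \<open>A\<close>, whose sum has denominator dividing
      \<open>d\<close>.\<close>
    define G where "G = filter_mset (\<lambda>x. x \<noteq> c) F"
    define k where "k = count F c"
    have FG: "F = G + replicate_mset k c"
      unfolding G_def k_def by (subst multiset_partition[of F "\<lambda>x. x \<noteq> c"]) (simp add: filter_eq_replicate_mset)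
    have GA: "set_mset G \<subseteq> A" using F(1) by (auto simp: G_def)
    have Gpos: "\<forall>x\<in>#G. 0 < x" using GA assms(2) atomlike_pos by auto
    have Gint: "of_nat d * sum_mset G \<in> \<int>"
      by (rule sum_mset_denominator) (use GA d in auto)
    have sF: "sum_mset F = sum_mset G + of_nat k * c"
      by (simp add: FG)
    show ?thesis
    proof (cases "sum_mset F = c")
      case True
      \<comment> \<open>Here \<open>(1 - k) * c\<close> is the sum of \<open>G\<close>, so
        \<open>p\<close> divides \<open>1 - k\<close>. Positivity forces \<open>k\<close> \<le> 1,
        and \<open>k = 0\<close> would make \<open>p\<close> divide 1; hence \<open>F\<close> is
        just \<open>c\<close>.\<close>
      have "of_int (1 - int k) * c = sum_mset G" using sF True by (simp add: algebra_simps)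
      then have dv: "p dvd 1 - int k" by (intro key) (simp only: Gint)
      have "of_nat k * c \<le> 1 * c" using sF True sum_mset_nonneg_rat[OF Gpos] by simp
      then have "k \<le> 1" using c0 by (simp add: mult_le_cancel_right)
      moreover have "k \<noteq> 0"
      proof
        assume "k = 0"
        then have "p dvd 1" using dv by simp
        then show False using p by simp
      qed
      ultimately have k1: "k = 1" by simp
      then have "G = {#}" using sF True sum_mset_eq_0_rat_iff[OF Gpos] by simp
      then show ?thesis using FG k1 by simp
    next
      case False
      then have sA: "sum_mset F \<in> A" using F by blast
      have "of_nat d * (of_int (int k) * c) = of_nat d * sum_mset F - of_nat d * sum_mset G"
        using sF by (simp add: algebra_simps)
      then have "of_nat d * (of_int (int k) * c) \<in> \<int>" using Gint sA d by simp
      then have "p dvd int k" by (rule key)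
      then obtain j where j: "int k = p * j" by blast
      have "0 \<le> p * j" using j by linarith
      then have "0 \<le> j" using p by (simp add: zero_le_mult_iff)
      then obtain i where i: "j = int i" using nonneg_int_cases by blast
      \<comment> \<open>Trade each of the \<open>i\<close> blocks of \<open>p\<close> copies of
        \<open>c\<close> for \<open>a + b\<close>. The result is a multiset over the old
        \<open>A\<close> with the same sum.\<close>
      define H where "H = G + replicate_mset i a + replicate_mset i b"
      have "of_nat k * c = of_int (int k) * c" by simp
      also have "\<dots> = of_nat i * (of_int p * c)" by (simp add: j i)
      also have "\<dots> = of_nat i * (a + b)" by (simp add: pc)
      finally have sH: "sum_mset H = sum_mset F"
        by (simp add: sF H_def algebra_simps)
      have "set_mset H \<subseteq> A" using GA assms by (auto simp: H_def)
      then have H: "H = {#sum_mset F#}" using atomlikeD[OF assms(2), of H] sA sH by simp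
      then have "size H = 1" by simp
      \<comment> \<open>\<open>H\<close> contains at least \<open>2 * i\<close> elements, so a
        singleton leaves no room for a traded block and \<open>c\<close> did not occur in
        \<open>F\<close>.\<close>
      then have "i = 0" by (simp add: H_def)
      then have "F = H" using j i by (simp add: FG H_def)
      then show ?thesis using H by simp
    qed
  qed
  then have "atomlike (insert c A)"
    using c0 assms(2) unfolding atomlike_def by blast
  moreover have "of_nat (nat p) * c = a + b" using pc p by simp
  ultimately show ?thesis using p by (intro exI[of _ c] exI[of _ "nat p"]) auto
qed

section \<open>Treating all pairs and passing to the limit\<close>

lemma atomlike_extend_pairs:
  assumes "finite A" "atomlike A" "finite P" "P \<subseteq> A \<times> A"
  shows "\<exists>B. finite B \<and> atomlike B \<and> A \<subseteq> B \<and>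
    (\<forall>(a, b)\<in>P. \<exists>c\<in>B. \<exists>p\<ge>3. of_nat p * c = a + b)"
  using assms(3,4)
proof (induction P)
  case empty
  show ?case using assms by auto
next
  case (insert q P)
  obtain a b where q: "q = (a, b)" by (cases q)
  obtain B where B: "finite B" "atomlike B" "A \<subseteq> B"
    "\<forall>(a, b)\<in>P. \<exists>c\<in>B. \<exists>p\<ge>3. of_nat p * c = a + b"
    using insert by auto
  obtain c p where c: "atomlike (insert c B)" "3 \<le> p" "of_nat p * c = a + b"
    using atomlike_extend[OF B(1,2), of a b] insert.prems q B(3) by auto
  \<comment> \<open>Witnesses for earlier pairs persist because the set only grows. Pairs involving
    the new elements are left to a later stage.\<close>
  have "\<forall>(a, b)\<in>insert q P. \<exists>c\<in>insert c B. \<exists>p\<ge>3. of_nat p * c = a + b"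
    using B(4) c(2,3) unfolding q by blast
  then show ?case
    using B(1,3) c(1) by (intro exI[of _ "insert c B"]) auto
qed

text \<open>A finite multiset over the union, together with its sum, already lies in a single
  stage.\<close>

lemma atomlike_UN_incseq:
  assumes "\<And>n. atomlike (A n)" "incseq A"
  shows "atomlike (\<Union>n. A n)"
proof -
  have sub: "\<exists>n. S \<subseteq> A n" if "finite S" "S \<subseteq> (\<Union>n. A n)" for S
    using that
  proof induction
    case (insert x S)
    then obtain m n where "S \<subseteq> A n" "x \<in> A m" by auto
    then have "insert x S \<subseteq> A (max m n)"
      using incseqD[OF assms(2)] max.cobounded1 max.cobounded2 by blast
    then show ?case ..
  qed simp
  have "F = {#sum_mset F#}" if F: "set_mset F \<subseteq> (\<Union>n. A n)" "sum_mset F \<in> (\<Union>n. A n)" for F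
  proof -
    have "\<exists>n. insert (sum_mset F) (set_mset F) \<subseteq> A n"
      by (rule sub) (use F in auto)
    then obtain n where "insert (sum_mset F) (set_mset F) \<subseteq> A n" ..
    then show ?thesis using atomlikeD[OF assms(1)] by auto
  qed
  then show ?thesis
    using assms(1) unfolding atomlike_def by blast
qed

lemma exists_pair_closed_atomlike:
  "\<exists>A. atomlike A \<and> 1 \<in> A \<and>
     (\<forall>a\<in>A. \<forall>b\<in>A. \<exists>c\<in>A. \<exists>p\<ge>3. of_nat p * c = a + b)"
proof -
  have "\<exists>A. \<forall>n. (finite (A n) \<and> atomlike (A n) \<and> 1 \<in> A n) \<and>
    (A n \<subseteq> A (Suc n) \<and> (\<forall>(a, b)\<in>A n \<times> A n. \<exists>c\<in>A (Suc n). \<exists>p\<ge>3. of_nat p * c = a + b))"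
  \<comment> \<open>Stage \<open>Suc n\<close> treats every pair from stage \<open>n\<close>.
    Finiteness is carried along because the next stage needs finitely many pairs and a common
    denominator.\<close>
  proof (rule dependent_nat_choice, goal_cases)
    case 1
    show ?case using atomlike_one by (intro exI[of _ "{1}"]) simp
  next
    case (2 S n)
    then obtain B where "finite B" "atomlike B" "S \<subseteq> B"
      "\<forall>(a, b)\<in>S \<times> S. \<exists>c\<in>B. \<exists>p\<ge>3. of_nat p * c = a + b"
      using atomlike_extend_pairs[of S "S \<times> S"] by auto
    then show ?case using 2 by (intro exI[of _ B]) auto
  qed
  then obtain A where seq: "\<forall>n. (finite (A n) \<and> atomlike (A n) \<and> 1 \<in> A n) \<and>
    (A n \<subseteq> A (Suc n) \<and> (\<forall>(a, b)\<in>A n \<times> A n. \<exists>c\<in>A (Suc n). \<exists>p\<ge>3. of_nat p * c = a + b))" ..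
  then have A: "atomlike (A n)" "1 \<in> A n" "A n \<subseteq> A (Suc n)" for n
    by simp_all
  have pairs: "\<exists>c\<in>A (Suc n). \<exists>p\<ge>3. of_nat p * c = a + b"
    if "a \<in> A n" "b \<in> A n" for a b n
    using spec[OF seq, of n] that by simp
  have inc: "incseq A" using A(3) by (rule incseq_SucI)
  have "\<exists>c\<in>(\<Union>n. A n). \<exists>p\<ge>3. of_nat p * c = a + b" if "a \<in> A m" "b \<in> A n" for a b m n
  proof -
    \<comment> \<open>Atoms from different stages form a pair at the later of the two.\<close>
    have "a \<in> A (max m n)" "b \<in> A (max m n)"
      using that incseqD[OF inc, of m "max m n"] incseqD[OF inc, of n "max m n"] by auto
    from pairs[OF this] show ?thesis by blast
  qed
  then show ?thesis
    using atomlike_UN_incseq[OF A(1) inc] A(2) by (intro exI[of _ "\<Union>n. A n"]) auto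
qed

section \<open>The generated Puiseux monoid and its atoms\<close>

lemma puiseux_monoid_msums:
  assumes "\<And>x. x \<in> A \<Longrightarrow> 0 < x"
  shows "puiseux_monoid (msums A)"
proof -
  have "x + y \<in> msums A" if xy: "x \<in> msums A" "y \<in> msums A" for x y
  proof -
    obtain F G where "x = sum_mset F" "y = sum_mset G" "set_mset F \<subseteq> A" "set_mset G \<subseteq> A"
      using xy by (auto simp: msums_def)
    then have "x + y = sum_mset (F + G)" "set_mset (F + G) \<subseteq> A" by auto
    then show ?thesis unfolding msums_def by blast
  qed
  moreover have "0 \<le> x" if x: "x \<in> msums A" for x
  proof -
    obtain F where "x = sum_mset F" "set_mset F \<subseteq> A"
      using x by (auto simp: msums_def)
    then show ?thesis using assms sum_mset_nonneg_rat[of F] by auto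
  qed
  moreover have "0 \<in> msums A"
    unfolding msums_def by (intro CollectI exI[of _ "{#}"]) simp
  ultimately show ?thesis by (simp add: puiseux_monoid_def)
qed

lemma subset_msums: "A \<subseteq> msums A"
proof
  fix x assume "x \<in> A"
  then show "x \<in> msums A"
    unfolding msums_def by (intro CollectI exI[of _ "{#x#}"]) simp
qed

lemma msums_subset:
  assumes "puiseux_monoid T" "A \<subseteq> T"
  shows "msums A \<subseteq> T"
proof -
  have "sum_mset F \<in> T" if "set_mset F \<subseteq> A" for F
    using that assms by (induction F) (auto simp: puiseux_monoid_def)
  then show ?thesis by (auto simp: msums_def)
qed

lemma puiseux_monoid_hull_eq_msums:
  assumes "\<And>x. x \<in> A \<Longrightarrow> 0 < x"
  shows "puiseux_monoid hull A = msums A"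
  by (rule hull_unique) (rule subset_msums puiseux_monoid_msums assms msums_subset | assumption)+

lemma atoms_msums:
  assumes "atomlike A"
  shows "atoms (msums A) = A"
proof (intro equalityI subsetI)
  fix x assume x: "x \<in> A"
  have "u = 0 \<or> v = 0" if uv: "u \<in> msums A" "v \<in> msums A" "x = u + v" for u v
  proof -
    obtain F G where FG: "u = sum_mset F" "v = sum_mset G" "set_mset F \<subseteq> A" "set_mset G \<subseteq> A"
      using uv(1,2) by (auto simp: msums_def)
    \<comment> \<open>Merging representations of \<open>u\<close> and \<open>v\<close> gives one of
      \<open>x\<close> over \<open>A\<close>, which must be trivial; so one of the two was
      empty.\<close>
    then have "F + G = {#x#}"
      using atomlikeD[OF assms, of "F + G"] x uv(3) by simp
    then have "F = {#} \<or> G = {#}" by (auto simp: union_is_single)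
    then show ?thesis using FG by auto
  qed
  then show "x \<in> atoms (msums A)"
    using x subset_msums atomlike_pos[OF assms x] by (auto simp: atoms_def)
next
  fix x assume x: "x \<in> atoms (msums A)"
  then obtain F where F: "x = sum_mset F" "set_mset F \<subseteq> A" "x \<noteq> 0"
    by (auto simp: atoms_def msums_def)
  then obtain a G where G: "F = add_mset a G" by (cases F) auto
  have a: "a \<in> A" "0 < a" using F G atomlike_pos[OF assms] by auto
  have "sum_mset G \<in> msums A" using F G by (auto simp: msums_def)
  \<comment> \<open>Splitting one summand \<open>a\<close> off an atom leaves 0, so the atom is
    \<open>a\<close> itself.\<close>
  then have "a = 0 \<or> sum_mset G = 0"
    using x a(1) subset_msums F(1) G by (auto simp: atoms_def)
  then show "x \<in> A" using a F(1) G by simp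
qed

text \<open>The monoid {0} has {0} as its only set of lengths and would be a degenerate witness;
  \<open>M\<close> \<noteq> {0} rules it out.\<close>

theorem theorem5p5:
  shows "\<exists>M. puiseux_monoid M \<and> M \<noteq> {0} \<and> atomic M \<and> {2} \<notin> system_of_sets_of_lengths M"
proof -
  obtain A where A: "atomlike A" "1 \<in> A"
    and pairs: "\<And>a b. a \<in> A \<Longrightarrow> b \<in> A \<Longrightarrow> \<exists>c\<in>A. \<exists>p\<ge>3. of_nat p * c = a + b"
    using exists_pair_closed_atomlike by blast
  have "set_of_lengths (msums A) x \<noteq> {2}" for x
  proof
    assume L: "set_of_lengths (msums A) x = {2}"
    then have "2 \<in> size ` factorizations (msums A) x"
      by (simp add: set_of_lengths_def)
    then obtain F where F: "F \<in> factorizations (msums A) x" "size F = 2"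
      by auto
    then obtain a G where G: "F = add_mset a G" "size G = 1"
      by (cases F) auto
    obtain b where "F = {#a, b#}"
      using size_1_singleton_mset[OF G(2)] G(1) by blast
    then have ab: "a \<in> A" "b \<in> A" "x = a + b"
      using F(1) by (auto simp: factorizations_def atoms_msums[OF A(1)])
    then obtain c p where c: "c \<in> A" "3 \<le> p" "of_nat p * c = a + b"
      using pairs by blast
    \<comment> \<open>A factorization of length 2 thus always comes with one of length
      \<open>p\<close> \<ge> 3.\<close>
    then have "replicate_mset p c \<in> factorizations (msums A) x"
      using ab by (auto simp: factorizations_def atoms_msums[OF A(1)])
    then have "size (replicate_mset p c) \<in> set_of_lengths (msums A) x"
      unfolding set_of_lengths_def by (rule imageI)
    then show False using L c(2) by simp
  qed
  then have "{2} \<notin> system_of_sets_of_lengths (msums A)"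
    unfolding system_of_sets_of_lengths_def by auto
  moreover have "atomic (msums A)"
    using puiseux_monoid_hull_eq_msums[OF atomlike_pos[OF A(1)]]
    by (simp add: atomic_def atoms_msums[OF A(1)])
  moreover have "puiseux_monoid (msums A)"
    using puiseux_monoid_msums[OF atomlike_pos[OF A(1)]] .
  moreover have "msums A \<noteq> {0}" using subsetD[OF subset_msums A(2)] by auto
  ultimately show ?thesis by blast
qed

end
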